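(* Let $t\ge2$ be an integer, let $N_t=|V(G_{2^t})|=2^{4t-1}-1$, and let $n_+(A_{2^t})$, $n_-(A_{2^t})$, $n_0(A_{2^t})$ denote the positive, negative and zero inertia indices of $A_{2^t}$. With $c_t=2^{4\lfloor t/2\rfloor}-1$, $$n_+(A_{2^t})\ge1,\qquad n_-(A_{2^t})\ge c_t-1.$$ Consequently, $$\operatorname{rank}(A_{2^t})\ge c_t,\qquad n_0(A_{2^t})\le N_t-c_t.$$
   Context: For $n\ge2$, $\mathbb{L}_n=\{a+bi+cj+dk: a,b,c,d\in\mathbb{Z}/n\mathbb{Z}\}$ is the ring of Lipschitz quaternions modulo $n$, with the usual relations $i^2=j^2=k^2=-1$, $ij=k=-ji$, $jk=i=-kj$, $ki=j=-ik$ taken modulo $n$. A nonzero element $x$ of a ring is a zero divisor if $xy=0$ or $yx=0$ for some nonzero $y$. $G_n=\Gamma(\mathbb{L}_n)$ is the simple undirected graph whose vertices are the nonzero zero divisors of $\mathbb{L}_n$, distinct $x,y$ being adjacent iff $xy=0$ or $yx=0$; $A_n=A(G_n)$ is its adjacency matrix. The positive, negative and zero inertia indices of a real symmetric matrix are the numbers of its positive, negative and zero eigenvalues, counted with multiplicity. *)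

theory Defs
  imports
    "HOL-Number_Theory.Residues"
    "Graph_Theory.Pair_Digraph"
    "Jordan_Normal_Form.Char_Poly"
    "Jordan_Normal_Form.DL_Rank"
begin

section \<open>Lipschitz quaternions modulo n\<close>

text \<open>The tuple \<open>(a, b, c, d)\<close> stands for \<open>a + b i + c j + d k\<close>. The product is the
  bilinear one given by the relations
  \<open>i\<^sup>2 = j\<^sup>2 = k\<^sup>2 = -1\<close>, \<open>i j = k = - j i\<close>, \<open>j k = i = - k j\<close>, \<open>k i = j = - i k\<close>.\<close>

definition quaternion_ring :: "('a, 'm) ring_scheme \<Rightarrow> ('a \<times> 'a \<times> 'a \<times> 'a) ring" where
  "quaternion_ring R =
    \<lparr>carrier = carrier R \<times> carrier R \<times> carrier R \<times> carrier R,
     monoid.mult = (\<lambda>(a, b, c, d) (a', b', c', d').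
       (a \<otimes>\<^bsub>R\<^esub> a' \<ominus>\<^bsub>R\<^esub> b \<otimes>\<^bsub>R\<^esub> b' \<ominus>\<^bsub>R\<^esub> c \<otimes>\<^bsub>R\<^esub> c' \<ominus>\<^bsub>R\<^esub> d \<otimes>\<^bsub>R\<^esub> d',
        a \<otimes>\<^bsub>R\<^esub> b' \<oplus>\<^bsub>R\<^esub> b \<otimes>\<^bsub>R\<^esub> a' \<oplus>\<^bsub>R\<^esub> c \<otimes>\<^bsub>R\<^esub> d' \<ominus>\<^bsub>R\<^esub> d \<otimes>\<^bsub>R\<^esub> c',
        a \<otimes>\<^bsub>R\<^esub> c' \<ominus>\<^bsub>R\<^esub> b \<otimes>\<^bsub>R\<^esub> d' \<oplus>\<^bsub>R\<^esub> c \<otimes>\<^bsub>R\<^esub> a' \<oplus>\<^bsub>R\<^esub> d \<otimes>\<^bsub>R\<^esub> b',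
        a \<otimes>\<^bsub>R\<^esub> d' \<oplus>\<^bsub>R\<^esub> b \<otimes>\<^bsub>R\<^esub> c' \<ominus>\<^bsub>R\<^esub> c \<otimes>\<^bsub>R\<^esub> b' \<oplus>\<^bsub>R\<^esub> d \<otimes>\<^bsub>R\<^esub> a')),
     one = (\<one>\<^bsub>R\<^esub>, \<zero>\<^bsub>R\<^esub>, \<zero>\<^bsub>R\<^esub>, \<zero>\<^bsub>R\<^esub>),
     zero = (\<zero>\<^bsub>R\<^esub>, \<zero>\<^bsub>R\<^esub>, \<zero>\<^bsub>R\<^esub>, \<zero>\<^bsub>R\<^esub>),
     add = (\<lambda>(a, b, c, d) (a', b', c', d').
       (a \<oplus>\<^bsub>R\<^esub> a', b \<oplus>\<^bsub>R\<^esub> b', c \<oplus>\<^bsub>R\<^esub> c', d \<oplus>\<^bsub>R\<^esub> d'))\<rparr>"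

definition lipschitz_ring :: "nat \<Rightarrow> (int \<times> int \<times> int \<times> int) ring" where
  "lipschitz_ring n = quaternion_ring (residue_ring (int n))"

lemma lipschitz_ring_simps:
  "carrier (lipschitz_ring n) =
    {0..int n - 1} \<times> {0..int n - 1} \<times> {0..int n - 1} \<times> {0..int n - 1}"
  "\<one>\<^bsub>lipschitz_ring n\<^esub> = (1, 0, 0, 0)"
  "\<zero>\<^bsub>lipschitz_ring n\<^esub> = (0, 0, 0, 0)"
  "(a, b, c, d) \<oplus>\<^bsub>lipschitz_ring n\<^esub> (a', b', c', d') =
    ((a + a') mod int n, (b + b') mod int n, (c + c') mod int n, (d + d') mod int n)"
  by (simp_all add: lipschitz_ring_def quaternion_ring_def residue_ring_def)

lemma lipschitz_ring_mult:
  assumes "n \<ge> 2"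
  shows "(a, b, c, d) \<otimes>\<^bsub>lipschitz_ring n\<^esub> (a', b', c', d') =
    ((a * a' - b * b' - c * c' - d * d') mod int n,
     (a * b' + b * a' + c * d' - d * c') mod int n,
     (a * c' - b * d' + c * a' + d * b') mod int n,
     (a * d' + b * c' - c * b' + d * a') mod int n)"
proof -
  interpret residues "int n" "residue_ring (int n)"
    using assms by unfold_locales auto
  have minus: "x \<ominus>\<^bsub>residue_ring (int n)\<^esub> (y mod int n) = (x - y) mod int n" for x y
  proof -
    have "y mod int n \<in> carrier (residue_ring (int n))"
      by simp
    then have "\<ominus>\<^bsub>residue_ring (int n)\<^esub> (y mod int n) = (- y) mod int n"
      using res_neg_eq[of "y mod int n"] by (simp add: mod_minus_eq)
    then show ?thesis
      by (simp add: a_minus_def res_add_eq mod_simps)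
  qed
  show ?thesis
    by (simp add: lipschitz_ring_def quaternion_ring_def res_mult_eq minus res_add_eq mod_simps)
qed

lemma lipschitz_ring_mult_mod:
  assumes "n \<ge> 2"
  shows "(a mod int n, b mod int n, c mod int n, d mod int n) \<otimes>\<^bsub>lipschitz_ring n\<^esub> (a', b', c', d') =
      (a, b, c, d) \<otimes>\<^bsub>lipschitz_ring n\<^esub> (a', b', c', d')"
    and "(a, b, c, d) \<otimes>\<^bsub>lipschitz_ring n\<^esub> (a' mod int n, b' mod int n, c' mod int n, d' mod int n) =
      (a, b, c, d) \<otimes>\<^bsub>lipschitz_ring n\<^esub> (a', b', c', d')"
proof -
  have m: "[x mod int n = x] (mod int n)" for x
    by (simp add: Cong.cong_def)
  show "(a mod int n, b mod int n, c mod int n, d mod int n) \<otimes>\<^bsub>lipschitz_ring n\<^esub> (a', b', c', d') =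
      (a, b, c, d) \<otimes>\<^bsub>lipschitz_ring n\<^esub> (a', b', c', d')"
    "(a, b, c, d) \<otimes>\<^bsub>lipschitz_ring n\<^esub> (a' mod int n, b' mod int n, c' mod int n, d' mod int n) =
      (a, b, c, d) \<otimes>\<^bsub>lipschitz_ring n\<^esub> (a', b', c', d')"
    unfolding lipschitz_ring_mult[OF assms] prod.inject Cong.cong_def[symmetric]
    by (intro conjI cong_add cong_diff cong_mult m cong_refl)+
qed

lemma ring_lipschitz_ring:
  assumes n: "n \<ge> 2"
  shows "ring (lipschitz_ring n)"
proof (rule ringI)
  show "abelian_group (lipschitz_ring n)"
  proof (rule abelian_groupI)
    fix x assume "x \<in> carrier (lipschitz_ring n)"
    then obtain a b c d where x: "x = (a, b, c, d)"
      by (auto simp: lipschitz_ring_simps)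
    show "\<exists>y\<in>carrier (lipschitz_ring n). y \<oplus>\<^bsub>lipschitz_ring n\<^esub> x = \<zero>\<^bsub>lipschitz_ring n\<^esub>"
      by (rule bexI[of _ "((- a) mod int n, (- b) mod int n, (- c) mod int n, (- d) mod int n)"])
        (use n in \<open>auto simp: x lipschitz_ring_simps mod_simps\<close>)
  qed (use n in \<open>auto simp: lipschitz_ring_simps mod_simps add_ac\<close>)
  show "Group.monoid (lipschitz_ring n)"
  proof (rule monoidI)
    fix x y z :: "int \<times> int \<times> int \<times> int"
    obtain a b c d a' b' c' d' p q r s
      where xyz: "x = (a, b, c, d)" "y = (a', b', c', d')" "z = (p, q, r, s)"
      by (metis prod.collapse)
    show "(x \<otimes>\<^bsub>lipschitz_ring n\<^esub> y) \<otimes>\<^bsub>lipschitz_ring n\<^esub> z =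
        x \<otimes>\<^bsub>lipschitz_ring n\<^esub> (y \<otimes>\<^bsub>lipschitz_ring n\<^esub> z)"
      unfolding xyz lipschitz_ring_mult[OF n, of a b c d] lipschitz_ring_mult[OF n, of a' b' c' d']
        lipschitz_ring_mult_mod[OF n]
      unfolding lipschitz_ring_mult[OF n]
      by (simp add: algebra_simps)
  qed (use n in \<open>auto simp: lipschitz_ring_simps lipschitz_ring_mult\<close>)
next
  fix x y z :: "int \<times> int \<times> int \<times> int"
  obtain a b c d a' b' c' d' p q r s
    where xyz: "x = (a, b, c, d)" "y = (a', b', c', d')" "z = (p, q, r, s)"
    by (metis prod.collapse)
  show "(x \<oplus>\<^bsub>lipschitz_ring n\<^esub> y) \<otimes>\<^bsub>lipschitz_ring n\<^esub> z =
      x \<otimes>\<^bsub>lipschitz_ring n\<^esub> z \<oplus>\<^bsub>lipschitz_ring n\<^esub> y \<otimes>\<^bsub>lipschitz_ring n\<^esub> z"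
    and "z \<otimes>\<^bsub>lipschitz_ring n\<^esub> (x \<oplus>\<^bsub>lipschitz_ring n\<^esub> y) =
      z \<otimes>\<^bsub>lipschitz_ring n\<^esub> x \<oplus>\<^bsub>lipschitz_ring n\<^esub> z \<otimes>\<^bsub>lipschitz_ring n\<^esub> y"
    unfolding xyz lipschitz_ring_simps lipschitz_ring_mult_mod[OF n]
    unfolding lipschitz_ring_mult[OF n] lipschitz_ring_simps mod_add_eq
    by (simp_all add: algebra_simps)
qed

section \<open>Zero-divisor graphs\<close>

definition nonzero_zero_divisors :: "('a, 'm) ring_scheme \<Rightarrow> 'a set" where
  "nonzero_zero_divisors R =
    {x \<in> carrier R - {\<zero>\<^bsub>R\<^esub>}.
      \<exists>y \<in> carrier R - {\<zero>\<^bsub>R\<^esub>}. x \<otimes>\<^bsub>R\<^esub> y = \<zero>\<^bsub>R\<^esub> \<or> y \<otimes>\<^bsub>R\<^esub> x = \<zero>\<^bsub>R\<^esub>}"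

text \<open>A simple undirected graph is a \<^locale>\<open>pair_graph\<close>: each edge is represented by its
  two opposite arcs.\<close>

definition zero_divisor_graph :: "('a, 'm) ring_scheme \<Rightarrow> 'a pair_pre_digraph" where
  "zero_divisor_graph R =
    \<lparr>pverts = nonzero_zero_divisors R,
     parcs = {(x, y). x \<in> nonzero_zero_divisors R \<and> y \<in> nonzero_zero_divisors R \<and> x \<noteq> y \<and>
       (x \<otimes>\<^bsub>R\<^esub> y = \<zero>\<^bsub>R\<^esub> \<or> y \<otimes>\<^bsub>R\<^esub> x = \<zero>\<^bsub>R\<^esub>)}\<rparr>"

lemma pair_graph_zero_divisor_graph:
  assumes "finite (carrier R)"
  shows "pair_graph (zero_divisor_graph R)"
proof -
  have fin: "finite (nonzero_zero_divisors R)"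
    using assms by (simp add: nonzero_zero_divisors_def)
  then have "finite (parcs (zero_divisor_graph R))"
    by (auto simp: zero_divisor_graph_def intro: finite_subset[OF _ finite_cartesian_product[OF fin fin]])
  with fin show ?thesis
    by unfold_locales
      (auto simp: zero_divisor_graph_def symmetric_def arcs_ends_def arc_to_ends_def intro!: symI)
qed

abbreviation lipschitz_graph :: "nat \<Rightarrow> (int \<times> int \<times> int \<times> int) pair_pre_digraph" where
  "lipschitz_graph n \<equiv> zero_divisor_graph (lipschitz_ring n)"

lemma pair_graph_lipschitz_graph: "pair_graph (lipschitz_graph n)"
  by (rule pair_graph_zero_divisor_graph) (simp add: lipschitz_ring_simps)

section \<open>Adjacency matrices and inertia indices\<close>

text \<open>The list \<open>vs\<close> fixes the order of rows and columns; it is meant to enumerate the vertices of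
  \<open>G\<close> without repetition.\<close>

definition adjacency_matrix :: "'a pair_pre_digraph \<Rightarrow> 'a list \<Rightarrow> real mat" where
  "adjacency_matrix G vs =
    mat (length vs) (length vs) (\<lambda>(i, j). if (vs ! i, vs ! j) \<in> parcs G then 1 else 0)"

text \<open>Multiplicities are algebraic; for real symmetric matrices they coincide with the geometric
  ones.\<close>

definition eigenvalue_count :: "(real \<Rightarrow> bool) \<Rightarrow> real mat \<Rightarrow> nat" where
  "eigenvalue_count P A = (\<Sum>x | eigenvalue A x \<and> P x. order x (char_poly A))"

definition positive_inertia :: "real mat \<Rightarrow> nat" where
  "positive_inertia = eigenvalue_count (\<lambda>x. x > 0)"

definition negative_inertia :: "real mat \<Rightarrow> nat" where
  "negative_inertia = eigenvalue_count (\<lambda>x. x < 0)"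

definition zero_inertia :: "real mat \<Rightarrow> nat" where
  "zero_inertia = eigenvalue_count (\<lambda>x. x = 0)"

definition mat_rank :: "real mat \<Rightarrow> nat" where
  "mat_rank A = vec_space.rank (dim_row A) A"

end

theory Submission
  imports Defs "Jordan_Normal_Form.DL_Rank_Submatrix"
begin

text \<open>
  Let \<open>m = 2 ^ (t - t div 2)\<close>. The modulus \<open>2 ^ t\<close> divides \<open>m\<^sup>2\<close>, so any two multiples of \<open>m\<close> in
  the quaternion ring have product zero: its nonzero multiples of \<open>m\<close> are pairwise adjacent, and
  there are \<open>c = 2 ^ (4 * (t div 2)) - 1\<close> of them. On vectors supported on such a clique of \<open>c\<close>
  vertices, the quadratic form of the adjacency matrix is \<open>(\<Sum>z\<^sub>i)\<^sup>2 - \<Sum>z\<^sub>i\<^sup>2\<close>. It is negative definite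
  on the \<open>c - 1\<close> dimensional space of vectors with entry sum zero and positive on the constant
  vector. The principal submatrix of the clique, all ones minus the identity, is invertible, whence
  the bound on the rank.

  A space of dimension \<open>d\<close> on which the form is negative definite forces \<open>d\<close> negative eigenvalues:
  with fewer of them, some nonzero vector of the space would be orthogonal to all eigenvectors of
  negative eigenvalue, and the form would be nonnegative there. This rests on the spectral theorem
  for real symmetric matrices, which is derived below by splitting off one eigenvector at a time
  with a Householder reflection. It also shows that the three inertia indices add up to the size
  of the matrix, which turns the lower bounds on two of them into an upper bound on the third.

  Finally, the number of vertices: a quaternion modulo \<open>2 ^ t\<close> with odd coordinate sum has odd norm,
  so multiplying by its conjugate shows that it annihilates only zero, while every quaternion with
  even coordinate sum is annihilated by \<open>2 ^ (t - 1) (1 + i + j + k)\<close>. Thus exactly half of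
  the elements are zero or zero divisors.
\<close>

section \<open>The spectral theorem for real symmetric matrices\<close>

lemma scalar_prod_self_eq_sum_squares:
  fixes v :: "real vec"
  assumes "v \<in> carrier_vec n"
  shows "v \<bullet> v = (\<Sum>i<n. (v $ i)\<^sup>2)"
  using assms by (auto simp: scalar_prod_def power2_eq_square lessThan_atLeast0)

lemma scalar_prod_self_pos:
  fixes v :: "real vec"
  assumes "v \<in> carrier_vec n" "v \<noteq> 0\<^sub>v n"
  shows "v \<bullet> v > 0"
proof -
  obtain i where i: "i < n" "v $ i \<noteq> 0"
    using assms by (metis carrier_vecD eq_vecI index_zero_vec)
  then have "0 < (\<Sum>i<n. (v $ i)\<^sup>2)"
    by (intro sum_pos2[of _ i]) auto
  then show ?thesis
    by (simp add: scalar_prod_self_eq_sum_squares[OF assms(1)])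
qed

text \<open>A complex eigenvalue \<open>l\<close> exists. Split its eigenvector as \<open>x + iy\<close>: expanding both sides of
  \<open>Ay \<bullet> x = y \<bullet> Ax\<close> gives \<open>Im l * (x \<bullet> x + y \<bullet> y) = 0\<close>, so \<open>l\<close> is real and
  whichever of \<open>x\<close>, \<open>y\<close> is nonzero is an eigenvector.\<close>

lemma symmetric_real_eigenvalue_exists:
  fixes A :: "real mat"
  assumes A: "A \<in> carrier_mat n n" and sym: "transpose_mat A = A" and n: "n > 0"
  shows "\<exists>e. eigenvalue A e"
proof -
  let ?cA = "map_mat complex_of_real A"
  have cA: "?cA \<in> carrier_mat n n"
    using A by simp
  have "degree (char_poly ?cA) = n"
    using degree_monic_char_poly[OF cA] by simp
  then have "\<not> constant (poly (char_poly ?cA))"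
    using n by (simp add: constant_degree)
  then obtain l where "poly (char_poly ?cA) l = 0"
    using fundamental_theorem_of_algebra by blast
  then have "eigenvalue ?cA l"
    by (simp add: eigenvalue_root_char_poly[OF cA])
  then obtain z where z: "z \<in> carrier_vec n" "z \<noteq> 0\<^sub>v n" "?cA *\<^sub>v z = l \<cdot>\<^sub>v z"
    using A by (auto simp: eigenvalue_def eigenvector_def)
  define x where "x = map_vec Re z"
  define y where "y = map_vec Im z"
  have xy: "x \<in> carrier_vec n" "y \<in> carrier_vec n"
    using z by (auto simp: x_def y_def)
  have row: "(\<Sum>j<n. complex_of_real (A $$ (i, j)) * z $ j) = l * z $ i" if "i < n" for i
    using arg_cong[OF z(3), of "\<lambda>v. v $ i"] that z(1) A
    by (simp add: scalar_prod_def lessThan_atLeast0)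
  have Ax: "A *\<^sub>v x = Re l \<cdot>\<^sub>v x - Im l \<cdot>\<^sub>v y"
  proof (rule eq_vecI)
    fix i assume "i < dim_vec (Re l \<cdot>\<^sub>v x - Im l \<cdot>\<^sub>v y)"
    then have i: "i < n" using xy by simp
    have "(\<Sum>j<n. A $$ (i, j) * Re (z $ j)) = Re (l * z $ i)"
      by (subst row[OF i, symmetric]) simp
    then show "(A *\<^sub>v x) $ i = (Re l \<cdot>\<^sub>v x - Im l \<cdot>\<^sub>v y) $ i"
      using i A z(1) by (simp add: x_def y_def scalar_prod_def lessThan_atLeast0)
  qed (use A xy in auto)
  have Ay: "A *\<^sub>v y = Im l \<cdot>\<^sub>v x + Re l \<cdot>\<^sub>v y"
  proof (rule eq_vecI)
    fix i assume "i < dim_vec (Im l \<cdot>\<^sub>v x + Re l \<cdot>\<^sub>v y)"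
    then have i: "i < n" using xy by simp
    have "(\<Sum>j<n. A $$ (i, j) * Im (z $ j)) = Im (l * z $ i)"
      by (subst row[OF i, symmetric]) simp
    then show "(A *\<^sub>v y) $ i = (Im l \<cdot>\<^sub>v x + Re l \<cdot>\<^sub>v y) $ i"
      using i A z(1) by (simp add: x_def y_def scalar_prod_def lessThan_atLeast0)
  qed (use A xy in auto)
  have "(A *\<^sub>v y) \<bullet> x = y \<bullet> (A *\<^sub>v x)"
    using transpose_vec_mult_scalar[OF A xy] by (simp add: sym)
  then have "Im l * (x \<bullet> x) + Re l * (y \<bullet> x) = Re l * (y \<bullet> x) - Im l * (y \<bullet> y)"
    unfolding Ax Ay using xy
    by (simp add: add_scalar_prod_distrib[of _ n] scalar_prod_minus_distrib[of _ n])
  then have *: "Im l * (x \<bullet> x + y \<bullet> y) = 0"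
    by (simp add: algebra_simps)
  have "x \<noteq> 0\<^sub>v n \<or> y \<noteq> 0\<^sub>v n"
  proof (rule ccontr)
    assume "\<not> ?thesis"
    then have 0: "x $ i = 0" "y $ i = 0" if "i < n" for i
      using that by auto
    have "z = 0\<^sub>v n"
      by (rule eq_vecI) (use 0 z(1) in \<open>auto simp: x_def y_def complex_eq_iff\<close>)
    with z(2) show False by simp
  qed
  moreover have "v \<bullet> v \<ge> 0" if "v \<in> carrier_vec n" for v :: "real vec"
    by (simp add: scalar_prod_self_eq_sum_squares[OF that] sum_nonneg)
  ultimately have "x \<bullet> x + y \<bullet> y > 0"
    using scalar_prod_self_pos[OF xy(1)] scalar_prod_self_pos[OF xy(2)] xy
    by (metis add_nonneg_pos add_pos_nonneg)
  with * have "Im l = 0" by simp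
  then have "A *\<^sub>v x = Re l \<cdot>\<^sub>v x" "A *\<^sub>v y = Re l \<cdot>\<^sub>v y"
    using Ax Ay xy by auto
  with \<open>x \<noteq> 0\<^sub>v n \<or> y \<noteq> 0\<^sub>v n\<close> have "eigenvalue A (Re l)"
    using A xy unfolding eigenvalue_def eigenvector_def by auto
  then show ?thesis ..
qed

text \<open>Reflection in the hyperplane orthogonal to \<open>v - e\<^sub>0\<close> swaps the unit vectors \<open>v\<close> and \<open>e\<^sub>0\<close>. Such an
  explicit symmetric orthogonal matrix replaces the completion of \<open>v\<close> to an orthonormal basis.\<close>

lemma householder_reflection:
  fixes v :: "real vec"
  assumes v: "v \<in> carrier_vec n" "v \<bullet> v = 1" and n: "n > 0"
  obtains H where "H \<in> carrier_mat n n" "transpose_mat H = H" "H * H = 1\<^sub>m n"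
    "H *\<^sub>v unit_vec n 0 = v"
proof -
  define u where "u = v - unit_vec n 0"
  have u: "u \<in> carrier_vec n" using v by (simp add: u_def)
  define s where "s = (\<Sum>k<n. (u $ k)\<^sup>2)"
  \<comment> \<open>If \<open>v = e\<^sub>0\<close>, then \<open>s = 0\<close>, hence \<open>c = 0\<close>, and the matrix below is the identity.\<close>
  define c where "c = 2 / s"
  have vv: "(\<Sum>k<n. (v $ k)\<^sup>2) = 1"
    using v(2) scalar_prod_self_eq_sum_squares[OF v(1)] by simp
  have uk: "u $ k = v $ k - (if k = 0 then 1 else 0)" if "k < n" for k
    using that v(1) n by (simp add: u_def)
  have "s = (\<Sum>k<n. (v $ k)\<^sup>2 + (if k = 0 then 1 - 2 * v $ k else 0))"
    unfolding s_def by (intro sum.cong refl) (auto simp: uk power2_eq_square algebra_simps)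
  also have "\<dots> = 2 - 2 * v $ 0"
    using n by (simp add: sum.distrib vv)
  finally have s: "s = - 2 * u $ 0"
    using uk[of 0] n by simp
  define H where "H = mat n n (\<lambda>(i, j). (if i = j then 1 else 0) - c * u $ i * u $ j)"
  show ?thesis
  proof (rule that)
    show H: "H \<in> carrier_mat n n" by (simp add: H_def)
    show "transpose_mat H = H"
      by (rule eq_matI) (auto simp: H_def)
    show "H * H = 1\<^sub>m n"
    proof (rule eq_matI)
      fix i j assume "i < dim_row (1\<^sub>m n :: real mat)" "j < dim_col (1\<^sub>m n :: real mat)"
      then have ij: "i < n" "j < n" by auto
      have "(H * H) $$ (i, j) = (\<Sum>k<n. ((if i = k then 1 else 0) - c * u $ i * u $ k) *
          ((if k = j then 1 else 0) - c * u $ k * u $ j))"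
        using ij by (simp add: H_def scalar_prod_def lessThan_atLeast0)
      also have "\<dots> = (\<Sum>k<n. (if k = i then (if i = j then 1 else 0) - c * u $ i * u $ j else 0)
          - (if k = j then c * u $ i * u $ j else 0) + (c * u $ i * u $ j) * (c * (u $ k)\<^sup>2))"
        by (intro sum.cong refl) (auto simp: algebra_simps power2_eq_square)
      also have "\<dots> = (if i = j then 1 else 0) - 2 * c * u $ i * u $ j + (c * u $ i * u $ j) * (c * s)"
        using ij by (simp add: sum.distrib sum_subtractf sum_distrib_left[symmetric] s_def)
      also have "\<dots> = (if i = j then 1 else 0)"
        by (cases "s = 0") (auto simp: c_def)
      finally show "(H * H) $$ (i, j) = 1\<^sub>m n $$ (i, j)"
        using ij by simp
    qed (auto simp: H_def)
    show "H *\<^sub>v unit_vec n 0 = v"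
    proof (rule eq_vecI)
      fix i assume "i < dim_vec v"
      then have i: "i < n" using v by simp
      have "(H *\<^sub>v unit_vec n 0) $ i = (if i = 0 then 1 else 0) - c * u $ i * u $ 0"
        using i n by (simp add: H_def)
      also have "\<dots> = (if i = 0 then 1 else 0) + u $ i"
      proof (cases "s = 0")
        case True
        then have "u $ i = 0"
          using i by (auto simp: s_def sum_nonneg_eq_0_iff)
        then show ?thesis by simp
      next
        case False
        then have "c * u $ 0 = - 1"
          using s by (simp add: c_def field_simps)
        then have "c * u $ i * u $ 0 = - u $ i"
          by (metis mult.assoc mult.commute mult_minus1)
        then show ?thesis by simp
      qed
      also have "\<dots> = v $ i" using uk[OF i] by simp
      finally show "(H *\<^sub>v unit_vec n 0) $ i = v $ i" .
    qed (use v H in auto)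
  qed
qed

text \<open>Conjugating \<open>A\<close> by a reflection that carries \<open>e\<^sub>0\<close> to a unit eigenvector gives a symmetric matrix whose
  first column, and hence first row, vanishes off the diagonal; the remaining block is symmetric
  and smaller.\<close>

lemma real_spectral_theorem:
  fixes A :: "real mat"
  assumes "A \<in> carrier_mat n n" "transpose_mat A = A"
  shows "\<exists>P D. P \<in> carrier_mat n n \<and> D \<in> carrier_mat n n \<and> transpose_mat P * P = 1\<^sub>m n \<and>
    diagonal_mat D \<and> transpose_mat P * A * P = D"
  using assms
proof (induction n arbitrary: A)
  case 0
  then show ?case
    by (intro exI[of _ "1\<^sub>m 0"] exI[of _ A]) (auto simp: diagonal_mat_def)
next
  case (Suc n)
  note A = Suc.prems(1) and sym = Suc.prems(2)
  obtain e where "eigenvalue A e"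
    using symmetric_real_eigenvalue_exists[OF A sym] by auto
  then obtain w where w: "w \<in> carrier_vec (Suc n)" "w \<noteq> 0\<^sub>v (Suc n)" "A *\<^sub>v w = e \<cdot>\<^sub>v w"
    using A by (auto simp: eigenvalue_def eigenvector_def)
  define v where "v = (1 / sqrt (w \<bullet> w)) \<cdot>\<^sub>v w"
  have v: "v \<in> carrier_vec (Suc n)" using w by (simp add: v_def)
  have "w \<bullet> w > 0" using scalar_prod_self_pos[OF w(1,2)] .
  then have vv: "v \<bullet> v = 1"
    using w(1) by (simp add: v_def)
  have Av: "A *\<^sub>v v = e \<cdot>\<^sub>v v"
    using mult_mat_vec[OF A w(1)] w(3) by (simp add: v_def smult_smult_assoc mult.commute)
  obtain H where H: "H \<in> carrier_mat (Suc n) (Suc n)" "transpose_mat H = H" "H * H = 1\<^sub>m (Suc n)"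
    "H *\<^sub>v unit_vec (Suc n) 0 = v"
    using householder_reflection[OF v vv] by auto
  let ?e0 = "unit_vec (Suc n) 0 :: real vec"
  define B where "B = H * A * H"
  have B: "B \<in> carrier_mat (Suc n) (Suc n)" using H A by (simp add: B_def)
  have Bsym: "transpose_mat B = B"
    using H A by (simp add: B_def sym transpose_mult[of _ "Suc n" "Suc n" _ "Suc n"])
  have Hv: "H *\<^sub>v v = ?e0"
    using assoc_mult_mat_vec[OF H(1) H(1), of ?e0] H by simp
  have "B *\<^sub>v ?e0 = H *\<^sub>v (A *\<^sub>v (H *\<^sub>v ?e0))"
    using H(1) A by (simp add: B_def assoc_mult_mat_vec[of _ "Suc n" "Suc n" _ "Suc n"])
  also have "\<dots> = e \<cdot>\<^sub>v ?e0"
    using mult_mat_vec[OF H(1) v] by (simp add: H(4) Av Hv)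
  finally have Be: "B *\<^sub>v ?e0 = e \<cdot>\<^sub>v ?e0" .
  have col: "B $$ (i, 0) = (if i = 0 then e else 0)" if "i < Suc n" for i
    using arg_cong[OF Be, of "\<lambda>x. x $ i"] that B by simp
  have row: "B $$ (0, i) = (if i = 0 then e else 0)" if "i < Suc n" for i
    using arg_cong[OF Bsym, of "\<lambda>M. M $$ (0, i)"] col[OF that] B that by simp
  define C where "C = mat n n (\<lambda>(i, j). B $$ (Suc i, Suc j))"
  have C: "C \<in> carrier_mat n n" by (simp add: C_def)
  have Csym: "transpose_mat C = C"
  proof (rule eq_matI)
    fix i j assume "i < dim_row C" "j < dim_col C"
    then show "transpose_mat C $$ (i, j) = C $$ (i, j)"
      using arg_cong[OF Bsym, of "\<lambda>M. M $$ (Suc i, Suc j)"] B by (simp add: C_def)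
  qed (simp_all add: C_def)
  define E where "E = mat 1 1 (\<lambda>_. e)"
  have E: "E \<in> carrier_mat 1 1" by (simp add: E_def)
  have Bblock: "B = four_block_mat E (0\<^sub>m 1 n) (0\<^sub>m n 1) C"
    by (rule eq_matI) (use B col row in \<open>auto simp: E_def C_def\<close>)
  obtain P D where P: "P \<in> carrier_mat n n" and D: "D \<in> carrier_mat n n"
    and PP: "transpose_mat P * P = 1\<^sub>m n" and diag: "diagonal_mat D" and PCP: "transpose_mat P * C * P = D"
    using Suc.IH[OF C Csym] by blast
  define Q where "Q = four_block_mat (1\<^sub>m 1) (0\<^sub>m 1 n) (0\<^sub>m n 1) P"
  define F where "F = four_block_mat E (0\<^sub>m 1 n) (0\<^sub>m n 1) D"
  have Q: "Q \<in> carrier_mat (Suc n) (Suc n)" using four_block_carrier_mat[of "1\<^sub>m 1" 1 1 P n n] P by (simp add: Q_def)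
  have Qt: "transpose_mat Q = four_block_mat (1\<^sub>m 1) (0\<^sub>m 1 n) (0\<^sub>m n 1) (transpose_mat P)"
    unfolding Q_def using P by (subst transpose_four_block_mat[of _ 1 1 _ n _ n]) auto
  have QQ: "transpose_mat Q * Q = 1\<^sub>m (Suc n)"
    unfolding Qt unfolding Q_def using P PP by (subst mult_four_block_mat[of _ 1 1 _ n _ n _ _ 1 _ n]) auto
  have QBQ: "transpose_mat Q * B * Q = F"
    unfolding Qt unfolding Q_def Bblock F_def using P C E PCP
    by (subst mult_four_block_mat[of _ 1 1 _ n _ n _ _ 1 _ n], auto)
       (subst mult_four_block_mat[of _ 1 1 _ n _ n _ _ 1 _ n], auto)
  have "transpose_mat (H * Q) = transpose_mat Q * H"
    using transpose_mult[OF H(1) Q] H(2) by simp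
  moreover have "transpose_mat Q * H * (H * Q) = transpose_mat Q * (H * H) * Q"
    using H(1) Q by (simp add: assoc_mult_mat[of _ "Suc n" "Suc n" _ "Suc n" _ "Suc n"] del: H(3))
  moreover have "transpose_mat Q * H * A * (H * Q) = transpose_mat Q * B * Q"
    using H(1) A Q by (simp add: B_def assoc_mult_mat[of _ "Suc n" "Suc n" _ "Suc n" _ "Suc n"])
  ultimately have "transpose_mat (H * Q) * (H * Q) = 1\<^sub>m (Suc n)"
    "transpose_mat (H * Q) * A * (H * Q) = F"
    using Q by (simp_all add: H(3) QQ QBQ)
  moreover have "F \<in> carrier_mat (Suc n) (Suc n)" using four_block_carrier_mat[OF E D] by (simp add: F_def)
  moreover have "diagonal_mat F"
    using diag D by (auto simp: diagonal_mat_def F_def E_def)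
  moreover have "H * Q \<in> carrier_mat (Suc n) (Suc n)" using H(1) Q by simp
  ultimately show ?case by blast
qed

section \<open>Inertia and definite subspaces\<close>

lemma order_prod_linear_factors:
  fixes x :: "'a :: idom"
  shows "order x (\<Prod>a\<leftarrow>es. [:- a, 1:]) = count_list es x"
proof (induction es)
  case (Cons a es)
  have "order x [:- a, 1:] = (if a = x then 1 else 0)"
    using order_linear_power[of x "- a" 1] by auto
  moreover have "(\<Prod>a\<leftarrow>es. [:- a, 1:]) \<noteq> 0"
    by (auto simp: prod_list_zero_iff)
  then have "[:- a, 1:] * (\<Prod>a\<leftarrow>es. [:- a, 1:]) \<noteq> 0"
    by (intro no_zero_divisors) auto
  ultimately show ?case
    using Cons order_mult[of "[:- a, 1:]" "\<Prod>a\<leftarrow>es. [:- a, 1:]" x] by (simp del: mult_pCons_left)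
qed simp

text \<open>Padding with zero rows makes the matrix square and singular.\<close>

lemma homogeneous_system_nontrivial_solution:
  fixes M :: "'a :: field mat"
  assumes M: "M \<in> carrier_mat r m" and "r < m"
  shows "\<exists>x \<in> carrier_vec m. x \<noteq> 0\<^sub>v m \<and> M *\<^sub>v x = 0\<^sub>v r"
proof -
  define M' where "M' = mat m m (\<lambda>(i, j). if i < r then M $$ (i, j) else 0)"
  have M': "M' \<in> carrier_mat m m" by (simp add: M'_def)
  have "transpose_mat M' *\<^sub>v unit_vec m r = 0\<^sub>v m"
    by (rule eq_vecI) (use assms in \<open>auto simp: M'_def\<close>)
  moreover have "unit_vec m r \<noteq> (0\<^sub>v m :: 'a vec)"
    using \<open>r < m\<close> by simp
  ultimately have "det (transpose_mat M') = 0"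
    using det_0_iff_vec_prod_zero_field[of "transpose_mat M'" m] M' by (meson transpose_carrier_mat unit_vec_carrier)
  then have "det M' = 0"
    using det_transpose[OF M'] by simp
  then obtain x where x: "x \<in> carrier_vec m" "x \<noteq> 0\<^sub>v m" "M' *\<^sub>v x = 0\<^sub>v m"
    using det_0_iff_vec_prod_zero_field[OF M'] by auto
  have "M *\<^sub>v x = 0\<^sub>v r"
  proof (rule eq_vecI)
    fix i assume "i < dim_vec (0\<^sub>v r :: 'a vec)"
    then have i: "i < r" "i < m" using \<open>r < m\<close> by auto
    have "row M i = row M' i"
      by (rule eq_vecI) (use i M in \<open>auto simp: M'_def\<close>)
    then have "(M *\<^sub>v x) $ i = (M' *\<^sub>v x) $ i"
      using i M M' by simp
    then show "(M *\<^sub>v x) $ i = 0\<^sub>v r $ i"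
      using x(3) i by simp
  qed (use M in simp)
  with x show ?thesis by blast
qed

text \<open>The columns of \<open>P\<close> are an orthonormal basis of eigenvectors of \<open>A\<close>, so \<open>P\<^sup>T x\<close> lists the coordinates
  of \<open>x\<close> in that basis.\<close>

locale orthogonal_diagonalization =
  fixes n :: nat and A P D :: "real mat"
  assumes A: "A \<in> carrier_mat n n" and P: "P \<in> carrier_mat n n" and D: "D \<in> carrier_mat n n"
    and orthogonal: "transpose_mat P * P = 1\<^sub>m n"
    and diagonal: "diagonal_mat D"
    and diagonalizes: "transpose_mat P * A * P = D"
begin

lemma orthogonal': "P * transpose_mat P = 1\<^sub>m n"
  using mat_mult_left_right_inverse[OF _ P orthogonal] P by simp

lemma decomposition: "A = P * D * transpose_mat P"
proof -
  have Pt: "transpose_mat P \<in> carrier_mat n n" using P by simp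
  note assoc = assoc_mult_mat[of _ n n _ n _ n]
  have "P * D * transpose_mat P = (P * transpose_mat P) * A * (P * transpose_mat P)"
    using A P Pt by (simp add: diagonalizes[symmetric] assoc)
  then show ?thesis
    using A by (simp add: orthogonal')
qed

lemma quadratic_form:
  assumes x: "x \<in> carrier_vec n"
  shows "x \<bullet> (A *\<^sub>v x) = (\<Sum>i<n. D $$ (i, i) * ((transpose_mat P *\<^sub>v x) $ i)\<^sup>2)"
proof -
  define y where "y = transpose_mat P *\<^sub>v x"
  have y: "y \<in> carrier_vec n" using P x by (simp add: y_def)
  have Dy: "D *\<^sub>v y \<in> carrier_vec n" using D y by simp
  have Dyi: "(D *\<^sub>v y) $ i = D $$ (i, i) * y $ i" if "i < n" for i
  proof -
    have "(D *\<^sub>v y) $ i = (\<Sum>j<n. D $$ (i, j) * y $ j)"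
      using that D y by (simp add: scalar_prod_def lessThan_atLeast0)
    also have "\<dots> = (\<Sum>j<n. if j = i then D $$ (i, i) * y $ i else 0)"
      using that D diagonal by (intro sum.cong refl) (auto simp: diagonal_mat_def)
    finally show ?thesis using that by simp
  qed
  have "A *\<^sub>v x = P *\<^sub>v (D *\<^sub>v y)"
    unfolding y_def using P D x
    by (subst decomposition) (simp add: assoc_mult_mat_vec[of _ n n _ n] assoc_mult_mat[of _ n n _ n _ n])
  then have "x \<bullet> (A *\<^sub>v x) = y \<bullet> (D *\<^sub>v y)"
    using transpose_vec_mult_scalar[OF P Dy x] by (simp add: y_def)
  also have "\<dots> = (\<Sum>i<n. D $$ (i, i) * (y $ i)\<^sup>2)"
    using D y by (auto simp: scalar_prod_def lessThan_atLeast0 Dyi power2_eq_square intro!: sum.cong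
        simp del: index_mult_mat_vec)
  finally show ?thesis by (simp add: y_def)
qed

lemma char_poly_eq: "char_poly A = (\<Prod>a\<leftarrow>diag_mat D. [:- a, 1:])"
proof -
  have "similar_mat_wit A D P (transpose_mat P)"
    by (rule similar_mat_witI[of _ _ n]) (use A P D orthogonal orthogonal' decomposition in auto)
  then have "char_poly A = char_poly D"
    by (intro char_poly_similar) (auto simp: similar_mat_def)
  moreover have "upper_triangular D"
    using diagonal D by (auto simp: upper_triangular_def diagonal_mat_def)
  ultimately show ?thesis
    using char_poly_upper_triangular[OF D] by simp
qed

lemma eigenvalue_count_eq_card:
  "eigenvalue_count Q A = card {i. i < n \<and> Q (D $$ (i, i))}"
proof -
  let ?ds = "diag_mat D"
  have "eigenvalue A x \<longleftrightarrow> x \<in> set ?ds" for x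
    by (auto simp: eigenvalue_root_char_poly[OF A] char_poly_eq poly_prod_list prod_list_zero_iff o_def)
  then have "eigenvalue_count Q A = (\<Sum>x\<in>set (filter Q ?ds). count_list ?ds x)"
    unfolding eigenvalue_count_def char_poly_eq order_prod_linear_factors
    by (intro sum.cong) auto
  also have "\<dots> = (\<Sum>x\<in>set (filter Q ?ds). count_list (filter Q ?ds) x)"
    by (intro sum.cong refl) (auto simp: count_list_eq_length_filter filter_filter intro!: arg_cong[of _ _ length] filter_cong)
  also have "\<dots> = length (filter Q ?ds)"
    by (rule sum_count_set) auto
  also have "\<dots> = card {i. i < n \<and> Q (D $$ (i, i))}"
    using D by (simp add: length_filter_conv_card diag_mat_def cong: conj_cong)
  finally show ?thesis .
qed

text \<open>Orthogonality to each of the eigenvectors concerned is one linear equation, and there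
  are fewer of these than unknowns.\<close>

lemma exists_vector_orthogonal_to_eigenspaces:
  assumes W: "W \<in> carrier_mat n m" and less: "eigenvalue_count Q A < m"
  shows "\<exists>x \<in> carrier_vec m. x \<noteq> 0\<^sub>v m \<and> (\<forall>i<n. Q (D $$ (i, i)) \<longrightarrow> (transpose_mat P *\<^sub>v (W *\<^sub>v x)) $ i = 0)"
proof -
  define js where "js = filter (\<lambda>i. Q (D $$ (i, i))) [0..<n]"
  have "length js = eigenvalue_count Q A"
    unfolding eigenvalue_count_eq_card js_def length_filter_conv_card
    by (intro arg_cong[of _ _ card]) auto
  define N where "N = mat (length js) m (\<lambda>(k, l). (transpose_mat P * W) $$ (js ! k, l))"
  obtain x where x: "x \<in> carrier_vec m" "x \<noteq> 0\<^sub>v m" "N *\<^sub>v x = 0\<^sub>v (length js)"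
    using homogeneous_system_nontrivial_solution[of N "length js" m] less \<open>length js = _\<close>
    by (auto simp: N_def)
  have "(transpose_mat P *\<^sub>v (W *\<^sub>v x)) $ i = 0" if i: "i < n" "Q (D $$ (i, i))" for i
  proof -
    have "i \<in> set js" using i by (simp add: js_def)
    then obtain k where k: "k < length js" "js ! k = i" by (auto simp: in_set_conv_nth)
    have "transpose_mat P *\<^sub>v (W *\<^sub>v x) = (transpose_mat P * W) *\<^sub>v x"
      using assoc_mult_mat_vec[of "transpose_mat P" n n W m x] P W x by simp
    moreover have "((transpose_mat P * W) *\<^sub>v x) $ i = (N *\<^sub>v x) $ k"
    proof -
      have "row (transpose_mat P * W) i = row N k"
        by (rule eq_vecI) (use i k P W in \<open>auto simp: N_def\<close>)
      then show ?thesis using i k P W by (simp add: N_def)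
    qed
    ultimately show ?thesis using x(3) k by simp
  qed
  with x show ?thesis by blast
qed

end

lemma symmetric_imp_orthogonal_diagonalization:
  assumes "A \<in> carrier_mat n n" "transpose_mat A = A"
  obtains P D where "orthogonal_diagonalization n A P D"
  using real_spectral_theorem[OF assms] assms
  by (metis orthogonal_diagonalization.intro)

text \<open>The columns of \<open>W\<close> span the space on which the form is negative definite; strict negativity for
  all nonzero coefficient vectors includes their independence. With fewer than \<open>m\<close> negative eigenvalues,
  some vector of that space would have only nonnegative eigenvalues contributing to its form. This
  is the inequality behind Sylvester's law of inertia.\<close>

lemma negative_inertia_ge:
  assumes A: "A \<in> carrier_mat n n" "transpose_mat A = A" and W: "W \<in> carrier_mat n m"
    and neg: "\<And>x. x \<in> carrier_vec m \<Longrightarrow> x \<noteq> 0\<^sub>v m \<Longrightarrow> (W *\<^sub>v x) \<bullet> (A *\<^sub>v (W *\<^sub>v x)) < 0"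
  shows "m \<le> negative_inertia A"
proof (rule ccontr)
  assume less: "\<not> ?thesis"
  obtain P D where "orthogonal_diagonalization n A P D"
    using symmetric_imp_orthogonal_diagonalization[OF A] .
  then interpret orthogonal_diagonalization n A P D .
  obtain x where x: "x \<in> carrier_vec m" "x \<noteq> 0\<^sub>v m"
    and orth: "\<And>i. i < n \<Longrightarrow> D $$ (i, i) < 0 \<Longrightarrow> (transpose_mat P *\<^sub>v (W *\<^sub>v x)) $ i = 0"
    using exists_vector_orthogonal_to_eigenspaces[OF W, of "\<lambda>x. x < 0"] less
    by (auto simp: negative_inertia_def)
  have "0 \<le> (\<Sum>i<n. D $$ (i, i) * ((transpose_mat P *\<^sub>v (W *\<^sub>v x)) $ i)\<^sup>2)"
  proof (rule sum_nonneg)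
    fix i assume "i \<in> {..<n}"
    then show "0 \<le> D $$ (i, i) * ((transpose_mat P *\<^sub>v (W *\<^sub>v x)) $ i)\<^sup>2"
      using orth[of i] by (cases "D $$ (i, i) < 0") auto
  qed
  also have "\<dots> = (W *\<^sub>v x) \<bullet> (A *\<^sub>v (W *\<^sub>v x))"
    using quadratic_form[of "W *\<^sub>v x"] W x by simp
  finally show False
    using neg[OF x] by simp
qed

lemma positive_inertia_ge:
  assumes A: "A \<in> carrier_mat n n" "transpose_mat A = A" and W: "W \<in> carrier_mat n m"
    and pos: "\<And>x. x \<in> carrier_vec m \<Longrightarrow> x \<noteq> 0\<^sub>v m \<Longrightarrow> (W *\<^sub>v x) \<bullet> (A *\<^sub>v (W *\<^sub>v x)) > 0"
  shows "m \<le> positive_inertia A"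
proof (rule ccontr)
  assume less: "\<not> ?thesis"
  obtain P D where "orthogonal_diagonalization n A P D"
    using symmetric_imp_orthogonal_diagonalization[OF A] .
  then interpret orthogonal_diagonalization n A P D .
  obtain x where x: "x \<in> carrier_vec m" "x \<noteq> 0\<^sub>v m"
    and orth: "\<And>i. i < n \<Longrightarrow> D $$ (i, i) > 0 \<Longrightarrow> (transpose_mat P *\<^sub>v (W *\<^sub>v x)) $ i = 0"
    using exists_vector_orthogonal_to_eigenspaces[OF W, of "\<lambda>x. x > 0"] less
    by (auto simp: positive_inertia_def)
  have "(W *\<^sub>v x) \<bullet> (A *\<^sub>v (W *\<^sub>v x)) =
      (\<Sum>i<n. D $$ (i, i) * ((transpose_mat P *\<^sub>v (W *\<^sub>v x)) $ i)\<^sup>2)"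
    using quadratic_form[of "W *\<^sub>v x"] W x by simp
  also have "\<dots> \<le> 0"
  proof (rule sum_nonpos)
    fix i assume "i \<in> {..<n}"
    then show "D $$ (i, i) * ((transpose_mat P *\<^sub>v (W *\<^sub>v x)) $ i)\<^sup>2 \<le> 0"
      using orth[of i] by (cases "D $$ (i, i) > 0") (auto simp: mult_nonpos_nonneg)
  qed
  finally show False
    using pos[OF x] by simp
qed

lemma inertia_sum:
  assumes A: "A \<in> carrier_mat n n" "transpose_mat A = A"
  shows "positive_inertia A + negative_inertia A + zero_inertia A = n"
proof -
  obtain P D where "orthogonal_diagonalization n A P D"
    using symmetric_imp_orthogonal_diagonalization[OF A] .
  then interpret orthogonal_diagonalization n A P D .
  let ?S = "\<lambda>Q. {i. i < n \<and> Q (D $$ (i, i))}"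
  have "n = card (?S (\<lambda>x. x > 0) \<union> ?S (\<lambda>x. x < 0) \<union> ?S (\<lambda>x. x = 0))"
    by (subst (1) card_lessThan[symmetric]) (rule arg_cong[of _ _ card], auto)
  also have "\<dots> = card (?S (\<lambda>x. x > 0) \<union> ?S (\<lambda>x. x < 0)) + card (?S (\<lambda>x. x = 0))"
    by (intro card_Un_disjoint) auto
  also have "card (?S (\<lambda>x. x > 0) \<union> ?S (\<lambda>x. x < 0)) = card (?S (\<lambda>x. x > 0)) + card (?S (\<lambda>x. x < 0))"
    by (intro card_Un_disjoint) auto
  finally show ?thesis
    by (simp add: positive_inertia_def negative_inertia_def zero_inertia_def eigenvalue_count_eq_card)
qed

section \<open>Cliques in symmetric matrices\<close>

text \<open>The clique is a set \<open>I\<close> of row indices of a symmetric matrix; outside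
  \<open>I \<times> I\<close> the matrix need not have entries 0 and 1.\<close>

locale matrix_with_clique =
  fixes n :: nat and A :: "real mat" and I :: "nat set"
  assumes A: "A \<in> carrier_mat n n" and sym: "transpose_mat A = A"
    and I: "I \<subseteq> {..<n}"
    and clique: "\<And>i j. i \<in> I \<Longrightarrow> j \<in> I \<Longrightarrow> A $$ (i, j) = (if i = j then 0 else 1)"
begin

lemma finite_clique: "finite I"
  using I finite_subset by blast

lemma quadratic_form_on_clique:
  assumes z: "z \<in> carrier_vec n" and off: "\<And>i. i < n \<Longrightarrow> i \<notin> I \<Longrightarrow> z $ i = 0"
  shows "z \<bullet> (A *\<^sub>v z) = (\<Sum>i\<in>I. z $ i)\<^sup>2 - (\<Sum>i\<in>I. (z $ i)\<^sup>2)"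
proof -
  have "z \<bullet> (A *\<^sub>v z) = (\<Sum>i<n. z $ i * (\<Sum>j<n. A $$ (i, j) * z $ j))"
    using A z by (simp add: scalar_prod_def lessThan_atLeast0)
  also have "\<dots> = (\<Sum>i\<in>I. z $ i * (\<Sum>j\<in>I. A $$ (i, j) * z $ j))"
    using I off by (intro sum.mono_neutral_cong_right) (auto intro!: sum.mono_neutral_right)
  also have "\<dots> = (\<Sum>i\<in>I. z $ i * ((\<Sum>j\<in>I. z $ j) - z $ i))"
  proof (intro sum.cong refl)
    fix i assume i: "i \<in> I"
    have "(\<Sum>j\<in>I. A $$ (i, j) * z $ j) = (\<Sum>j\<in>I. z $ j - (if j = i then z $ i else 0))"
      using i by (intro sum.cong refl) (auto simp: clique)
    then show "z $ i * (\<Sum>j\<in>I. A $$ (i, j) * z $ j) = z $ i * ((\<Sum>j\<in>I. z $ j) - z $ i)"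
      using i finite_clique by (simp add: sum_subtractf)
  qed
  finally show ?thesis
    by (simp add: algebra_simps sum_subtractf sum_distrib_left power2_eq_square)
qed

lemma pick_clique:
  "k < card I \<Longrightarrow> pick I k \<in> I"
  "k < card I \<Longrightarrow> l < card I \<Longrightarrow> pick I k = pick I l \<longleftrightarrow> k = l"
  using pick_in_set_le[of k I] pick_mono_le[of k I l] pick_mono_le[of l I k]
  by (auto, metis less_irrefl linorder_neqE_nat)

text \<open>On vectors whose entries sum to zero only the negative term of the quadratic form is left.\<close>

lemma card_clique_minus_1_le_negative_inertia: "card I - 1 \<le> negative_inertia A"
proof -
  let ?m = "card I - 1"
  define s where "s = pick I"
  have s_in: "s k \<in> I" if "k < card I" for k
    using pick_clique(1) that by (simp add: s_def)
  have s_eq: "s k = s l \<longleftrightarrow> k = l" if "k < card I" "l < card I" for k l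
    using pick_clique(2) that by (simp add: s_def)
  \<comment> \<open>Column \<open>l\<close> is the unit vector at \<open>s (Suc l)\<close> minus the one at \<open>s 0\<close>; these columns are a basis
    of the vectors supported on the clique whose entries sum to zero.\<close>
  define W where "W = mat n ?m (\<lambda>(i, l). (if i = s (Suc l) then 1 else 0) - (if i = s 0 then 1 else 0) :: real)"
  have W: "W \<in> carrier_mat n ?m" by (simp add: W_def)
  have "(W *\<^sub>v x) \<bullet> (A *\<^sub>v (W *\<^sub>v x)) < 0" if x: "x \<in> carrier_vec ?m" "x \<noteq> 0\<^sub>v ?m" for x
  proof -
    define z where "z = W *\<^sub>v x"
    have z: "z \<in> carrier_vec n" using W x by (simp add: z_def)
    have zi: "z $ i = (\<Sum>l<?m. ((if i = s (Suc l) then 1 else 0) - (if i = s 0 then 1 else 0)) * x $ l)"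
      if "i < n" for i
      using that x by (simp add: z_def W_def scalar_prod_def lessThan_atLeast0)
    obtain l where l: "l < ?m" "x $ l \<noteq> 0"
      using x by (metis carrier_vecD eq_vecI index_zero_vec)
    have "(\<Sum>i\<in>I. z $ i) = (\<Sum>i\<in>I. \<Sum>l<?m. ((if i = s (Suc l) then 1 else 0) - (if i = s 0 then 1 else 0)) * x $ l)"
      using I by (intro sum.cong refl zi) auto
    also have "\<dots> = (\<Sum>l<?m. (\<Sum>i\<in>I. (if i = s (Suc l) then 1 else 0) - (if i = s 0 then 1 else 0)) * x $ l)"
      by (subst sum.swap) (simp add: sum_distrib_right)
    also have "\<dots> = 0"
      using s_in finite_clique by (intro sum.neutral) (auto simp: sum_subtractf)
    finally have sum0: "(\<Sum>i\<in>I. z $ i) = 0" .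
    have off: "z $ i = 0" if "i < n" "i \<notin> I" for i
      unfolding zi[OF that(1)] using that s_in l by (intro sum.neutral) (auto 0 4)
    let ?p = "s (Suc l)"
    have p: "?p \<in> I" using s_in[of "Suc l"] l by auto
    have "z $ ?p = (\<Sum>l'<?m. ((if ?p = s (Suc l') then 1 else 0) - (if ?p = s 0 then 1 else 0)) * x $ l')"
      using p I by (intro zi) auto
    also have "\<dots> = (\<Sum>l'<?m. if l' = l then x $ l else 0)"
      using l by (intro sum.cong refl) (auto simp: s_eq)
    finally have "z $ ?p = x $ l"
      using l by simp
    then have "z $ ?p \<noteq> 0" using l by simp
    then have "0 < (\<Sum>i\<in>I. (z $ i)\<^sup>2)"
      using p finite_clique by (intro sum_pos2[of _ ?p]) auto
    then show ?thesis
      using quadratic_form_on_clique[OF z off] sum0 by (simp add: z_def)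
  qed
  then show ?thesis by (rule negative_inertia_ge[OF A sym W])
qed

text \<open>The indicator vector of a clique of size \<open>c\<close> gives the form the value \<open>c\<^sup>2 - c\<close>.\<close>

lemma one_le_positive_inertia:
  assumes "card I \<ge> 2"
  shows "1 \<le> positive_inertia A"
proof -
  define W where "W = mat n 1 (\<lambda>(i, l). if i \<in> I then 1 else 0 :: real)"
  have W: "W \<in> carrier_mat n 1" by (simp add: W_def)
  have "(W *\<^sub>v x) \<bullet> (A *\<^sub>v (W *\<^sub>v x)) > 0" if x: "x \<in> carrier_vec 1" "x \<noteq> 0\<^sub>v 1" for x
  proof -
    define z where "z = W *\<^sub>v x"
    have z: "z \<in> carrier_vec n" using W x by (simp add: z_def)
    have zi: "z $ i = (if i \<in> I then x $ 0 else 0)" if "i < n" for i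
      using that x by (simp add: z_def W_def scalar_prod_def)
    have x0: "x $ 0 \<noteq> 0"
      using x by (metis carrier_vecD eq_vecI index_zero_vec less_one)
    have "z \<bullet> (A *\<^sub>v z) = (\<Sum>i\<in>I. z $ i)\<^sup>2 - (\<Sum>i\<in>I. (z $ i)\<^sup>2)"
      by (rule quadratic_form_on_clique[OF z]) (simp add: zi)
    also have "\<dots> = (\<Sum>i\<in>I. x $ 0)\<^sup>2 - (\<Sum>i\<in>I. (x $ 0)\<^sup>2)"
      using zi I by (simp add: subset_iff cong: sum.cong)
    also have "\<dots> = real (card I) * (real (card I) - 1) * (x $ 0)\<^sup>2"
      by (simp add: power2_eq_square algebra_simps)
    also have "\<dots> > 0"
      using assms x0 by simp
    finally show ?thesis
      by (simp add: z_def)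
  qed
  then show ?thesis by (rule positive_inertia_ge[OF A sym W])
qed

text \<open>A kernel vector of the principal submatrix has all entries equal to their sum \<open>S\<close>, so
  \<open>S = c S\<close> for the size \<open>c\<close> of the clique; for \<open>c = 1\<close> this is no contradiction and the
  submatrix is zero.\<close>

lemma card_clique_le_rank:
  assumes "card I \<noteq> 1"
  shows "card I \<le> mat_rank A"
proof -
  let ?c = "card I"
  let ?M = "submatrix A I I"
  have II: "{i. i < n \<and> i \<in> I} = I" using I by auto
  have M: "?M \<in> carrier_mat ?c ?c"
    using carrier_matD[OF A] by (intro carrier_matI) (simp_all only: dim_submatrix II)
  have Mij: "?M $$ (i, j) = (if i = j then 0 else 1)" if "i < ?c" "j < ?c" for i j
    using submatrix_index[of i A I j I] carrier_matD[OF A] that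
    by (simp only: II clique pick_clique)
  have "det ?M \<noteq> 0"
  proof
    assume "det ?M = 0"
    then obtain v where v: "v \<in> carrier_vec ?c" "v \<noteq> 0\<^sub>v ?c" "?M *\<^sub>v v = 0\<^sub>v ?c"
      using det_0_iff_vec_prod_zero_field[OF M] by auto
    define S where "S = (\<Sum>j<?c. v $ j)"
    have vS: "v $ i = S" if "i < ?c" for i
    proof -
      have "0 = (?M *\<^sub>v v) $ i" using v(3) that by simp
      also have "\<dots> = (\<Sum>j<?c. v $ j - (if j = i then v $ i else 0))"
        using that v(1) M by (auto simp: scalar_prod_def lessThan_atLeast0 Mij intro!: sum.cong)
      also have "\<dots> = S - v $ i"
        using that by (simp add: sum_subtractf S_def)
      finally show ?thesis by simp
    qed
    have "S = (\<Sum>j<?c. S)"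
      using S_def sum.cong[OF refl, of "{..<?c}" "\<lambda>j. v $ j" "\<lambda>_. S"] vS by simp
    then have "S = 0" using assms by auto
    then have "v = 0\<^sub>v ?c"
      using vS v(1) by (intro eq_vecI) auto
    with v(2) show False by simp
  qed
  then have "card {j. j < n \<and> j \<in> I} \<le> vec_space.rank n A"
    by (rule vec_space.rank_gt_minor[OF A])
  then show ?thesis
    using A by (simp add: II mat_rank_def)
qed

end

lemma symmetric_adjacency_matrix:
  assumes "pair_graph G"
  shows "transpose_mat (adjacency_matrix G vs) = adjacency_matrix G vs"
proof -
  interpret pair_graph G by fact
  have "(x, y) \<in> parcs G \<longleftrightarrow> (y, x) \<in> parcs G" for x y
    using arcs_symmetric by blast
  then show ?thesis
    by (intro eq_matI) (auto simp: adjacency_matrix_def)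
qed

lemma adjacency_matrix_clique:
  assumes G: "pair_graph G" and vs: "distinct vs" "K \<subseteq> set vs"
    and K: "\<And>x y. x \<in> K \<Longrightarrow> y \<in> K \<Longrightarrow> x \<noteq> y \<Longrightarrow> (x, y) \<in> parcs G"
  shows "matrix_with_clique (length vs) (adjacency_matrix G vs) {i. i < length vs \<and> vs ! i \<in> K}"
    and "card {i. i < length vs \<and> vs ! i \<in> K} = card K"
proof -
  interpret pair_graph G by fact
  have loopfree: "(x, x) \<notin> parcs G" for x
    using no_loops[of "(x, x)"] by auto
  show "matrix_with_clique (length vs) (adjacency_matrix G vs) {i. i < length vs \<and> vs ! i \<in> K}"
    using symmetric_adjacency_matrix[OF G, of vs] vs(1) K loopfree
    by unfold_locales (auto simp: adjacency_matrix_def nth_eq_iff_index_eq)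
  have "bij_betw ((!) vs) {i. i < length vs \<and> vs ! i \<in> K} K"
    using vs by (auto simp: bij_betw_def inj_on_def nth_eq_iff_index_eq in_set_conv_nth image_iff subset_iff)
  then show "card {i. i < length vs \<and> vs ! i \<in> K} = card K"
    by (rule bij_betw_same_card)
qed

section \<open>Zero divisors among quaternions modulo a power of two\<close>

lemma lipschitz_mult_eq_zero_iff:
  assumes "n \<ge> 2"
  shows "(a, b, c, d) \<otimes>\<^bsub>lipschitz_ring n\<^esub> (a', b', c', d') = \<zero>\<^bsub>lipschitz_ring n\<^esub> \<longleftrightarrow>
    int n dvd a * a' - b * b' - c * c' - d * d' \<and>
    int n dvd a * b' + b * a' + c * d' - d * c' \<and>
    int n dvd a * c' - b * d' + c * a' + d * b' \<and>
    int n dvd a * d' + b * c' - c * b' + d * a'"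
  by (simp add: lipschitz_ring_mult[OF assms] lipschitz_ring_simps dvd_eq_mod_eq_0)

text \<open>Multiplying the equation by the conjugate of \<open>a + bi + cj + dk\<close> leaves the norm times \<open>y\<close>. The
  combinations of the four coordinate equations in the proof are the coordinates of that product.\<close>

lemma coprime_norm_cancels:
  fixes a b c d :: int
  assumes n: "n \<ge> 2" and coprime: "coprime (int n) (a\<^sup>2 + b\<^sup>2 + c\<^sup>2 + d\<^sup>2)"
    and y: "y \<in> carrier (lipschitz_ring n)"
    and zero: "(a, b, c, d) \<otimes>\<^bsub>lipschitz_ring n\<^esub> y = \<zero>\<^bsub>lipschitz_ring n\<^esub> \<or>
      y \<otimes>\<^bsub>lipschitz_ring n\<^esub> (a, b, c, d) = \<zero>\<^bsub>lipschitz_ring n\<^esub>"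
  shows "y = \<zero>\<^bsub>lipschitz_ring n\<^esub>"
proof -
  obtain p q r s where y_eq: "y = (p, q, r, s)" by (metis prod.collapse)
  let ?N = "a\<^sup>2 + b\<^sup>2 + c\<^sup>2 + d\<^sup>2"
  have *: "int n dvd ?N * p \<and> int n dvd ?N * q \<and> int n dvd ?N * r \<and> int n dvd ?N * s"
    using zero
  proof
    assume "(a, b, c, d) \<otimes>\<^bsub>lipschitz_ring n\<^esub> y = \<zero>\<^bsub>lipschitz_ring n\<^esub>"
    then have e:
      "int n dvd a * p - b * q - c * r - d * s" "int n dvd a * q + b * p + c * s - d * r"
      "int n dvd a * r - b * s + c * p + d * q" "int n dvd a * s + b * r - c * q + d * p"
      by (simp_all add: y_eq lipschitz_mult_eq_zero_iff[OF n])
    have p: "int n dvd ?N * p"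
      using dvd_add[OF dvd_add[OF dvd_add[OF dvd_mult[OF e(1), of a] dvd_mult[OF e(2), of b]] dvd_mult[OF e(3), of c]] dvd_mult[OF e(4), of d]]
      by (simp add: algebra_simps power2_eq_square)
    have q: "int n dvd ?N * q"
      using dvd_add[OF dvd_diff[OF dvd_diff[OF dvd_mult[OF e(2), of a] dvd_mult[OF e(1), of b]] dvd_mult[OF e(4), of c]] dvd_mult[OF e(3), of d]]
      by (simp add: algebra_simps power2_eq_square)
    have r: "int n dvd ?N * r"
      using dvd_diff[OF dvd_diff[OF dvd_add[OF dvd_mult[OF e(3), of a] dvd_mult[OF e(4), of b]] dvd_mult[OF e(1), of c]] dvd_mult[OF e(2), of d]]
      by (simp add: algebra_simps power2_eq_square)
    have s: "int n dvd ?N * s"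
      using dvd_diff[OF dvd_add[OF dvd_diff[OF dvd_mult[OF e(4), of a] dvd_mult[OF e(3), of b]] dvd_mult[OF e(2), of c]] dvd_mult[OF e(1), of d]]
      by (simp add: algebra_simps power2_eq_square)
    from p q r s show ?thesis by blast
  next
    assume "y \<otimes>\<^bsub>lipschitz_ring n\<^esub> (a, b, c, d) = \<zero>\<^bsub>lipschitz_ring n\<^esub>"
    then have e:
      "int n dvd p * a - q * b - r * c - s * d" "int n dvd p * b + q * a + r * d - s * c"
      "int n dvd p * c - q * d + r * a + s * b" "int n dvd p * d + q * c - r * b + s * a"
      by (simp_all add: y_eq lipschitz_mult_eq_zero_iff[OF n])
    have p: "int n dvd ?N * p"
      using dvd_add[OF dvd_add[OF dvd_add[OF dvd_mult[OF e(1), of a] dvd_mult[OF e(2), of b]] dvd_mult[OF e(3), of c]] dvd_mult[OF e(4), of d]]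
      by (simp add: algebra_simps power2_eq_square)
    have q: "int n dvd ?N * q"
      using dvd_diff[OF dvd_add[OF dvd_diff[OF dvd_mult[OF e(2), of a] dvd_mult[OF e(1), of b]] dvd_mult[OF e(4), of c]] dvd_mult[OF e(3), of d]]
      by (simp add: algebra_simps power2_eq_square)
    have r: "int n dvd ?N * r"
      using dvd_add[OF dvd_diff[OF dvd_diff[OF dvd_mult[OF e(3), of a] dvd_mult[OF e(4), of b]] dvd_mult[OF e(1), of c]] dvd_mult[OF e(2), of d]]
      by (simp add: algebra_simps power2_eq_square)
    have s: "int n dvd ?N * s"
      using dvd_diff[OF dvd_diff[OF dvd_add[OF dvd_mult[OF e(4), of a] dvd_mult[OF e(3), of b]] dvd_mult[OF e(2), of c]] dvd_mult[OF e(1), of d]]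
      by (simp add: algebra_simps power2_eq_square)
    from p q r s show ?thesis by blast
  qed
  have "x = 0" if "int n dvd ?N * x" "0 \<le> x" "x < int n" for x
  proof -
    have "int n dvd x"
      using that(1) coprime by (simp add: coprime_dvd_mult_right_iff)
    then show ?thesis
      using that(2,3) zdvd_not_zless[of x "int n"] by fastforce
  qed
  with * y show ?thesis
    by (auto simp: y_eq lipschitz_ring_simps)
qed

text \<open>Modulo 2 the norm equals the coordinate sum, so an odd sum makes the norm a unit. If the sum is
  even, all coordinates of the product with \<open>1 + i + j + k\<close> are even.\<close>

lemma nonzero_zero_divisors_lipschitz_power_of_2:
  assumes t: "t \<ge> 1"
  shows "nonzero_zero_divisors (lipschitz_ring (2 ^ t)) =
    {(a, b, c, d) \<in> carrier (lipschitz_ring (2 ^ t)). even (a + b + c + d)} - {\<zero>\<^bsub>lipschitz_ring (2 ^ t)\<^esub>}"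
    (is "?Z = ?E")
proof -
  let ?R = "lipschitz_ring (2 ^ t)"
  have n: "(2 :: nat) ^ t \<ge> 2" using t by (metis one_le_numeral power_increasing power_one_right)
  have "even (a + b + c + d)" if "(a, b, c, d) \<in> ?Z" for a b c d
  proof (rule ccontr)
    assume "odd (a + b + c + d)"
    then have "odd (a\<^sup>2 + b\<^sup>2 + c\<^sup>2 + d\<^sup>2)" by auto
    then have "coprime (int (2 ^ t)) (a\<^sup>2 + b\<^sup>2 + c\<^sup>2 + d\<^sup>2)" by simp
    from coprime_norm_cancels[OF n this] that show False
      unfolding nonzero_zero_divisors_def by blast
  qed
  moreover have "(a, b, c, d) \<in> ?Z"
    if "(a, b, c, d) \<in> carrier ?R" "even (a + b + c + d)" "(a, b, c, d) \<noteq> \<zero>\<^bsub>?R\<^esub>" for a b c d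
  proof -
    define h :: int where "h = 2 ^ (t - 1)"
    have h: "int (2 ^ t) = h * 2"
      using t by (cases t) (simp_all add: h_def)
    have "h > 0" by (simp add: h_def)
    then have y: "(h, h, h, h) \<in> carrier ?R - {\<zero>\<^bsub>?R\<^esub>}"
      unfolding lipschitz_ring_simps h by auto
    have "(a, b, c, d) \<otimes>\<^bsub>?R\<^esub> (h, h, h, h) = \<zero>\<^bsub>?R\<^esub>"
    proof -
      have "a * h - b * h - c * h - d * h = h * (a - b - c - d)"
        "a * h + b * h + c * h - d * h = h * (a + b + c - d)"
        "a * h - b * h + c * h + d * h = h * (a - b + c + d)"
        "a * h + b * h - c * h + d * h = h * (a + b - c + d)"
        by (simp_all add: algebra_simps)
      then show ?thesis
        unfolding lipschitz_mult_eq_zero_iff[OF n] h using that(2) \<open>h > 0\<close> by simp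
    qed
    with that y show ?thesis
      unfolding nonzero_zero_divisors_def by blast
  qed
  moreover have "(a, b, c, d) \<in> carrier ?R - {\<zero>\<^bsub>?R\<^esub>}" if "(a, b, c, d) \<in> ?Z" for a b c d
    using that unfolding nonzero_zero_divisors_def by blast
  ultimately have eq: "(a, b, c, d) \<in> ?Z \<longleftrightarrow> (a, b, c, d) \<in> ?E" for a b c d
    by blast
  show ?thesis
  proof (rule Set.set_eqI)
    fix x :: "int \<times> int \<times> int \<times> int"
    obtain a b c d where x: "x = (a, b, c, d)" by (cases x)
    show "x \<in> ?Z \<longleftrightarrow> x \<in> ?E" unfolding x by (rule eq)
  qed
qed

lemma card_nonzero_zero_divisors_lipschitz_power_of_2:
  assumes t: "t \<ge> 1"
  shows "card (nonzero_zero_divisors (lipschitz_ring (2 ^ t))) = 2 ^ (4 * t - 1) - 1"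
proof -
  let ?R = "lipschitz_ring (2 ^ t)"
  let ?E = "{(a, b, c, d) \<in> carrier ?R. even (a + b + c + d)}"
  define h :: int where "h = 2 ^ (t - 1)"
  have h: "2 ^ t = 2 * h"
    using t by (cases t) (simp_all add: h_def)
  let ?C = "{0..2 ^ t - 1 :: int}"
  let ?f = "\<lambda>(a, b, c, e). (a, b, c, 2 * e + (a + b + c) mod 2) :: int \<times> int \<times> int \<times> int"
  \<comment> \<open>The first three coordinates are free, and they determine the parity of the last one.\<close>
  have "bij_betw ?f (?C \<times> ?C \<times> ?C \<times> {0..h - 1}) ?E"
    by (rule bij_betw_byWitness[where f' = "\<lambda>(a, b, c, d). (a, b, c, d div 2)"])
      (auto simp: lipschitz_ring_simps h, presburger+)
  then have "card ?E = card (?C \<times> ?C \<times> ?C \<times> {0..h - 1})"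
    by (rule bij_betw_same_card[symmetric])
  also have "\<dots> = 2 ^ t * (2 ^ t * (2 ^ t * 2 ^ (t - 1)))"
    by (simp add: card_cartesian_product h_def nat_power_eq)
  also have "\<dots> = 2 ^ (4 * t - 1)"
    using t by (simp add: power_add[symmetric])
  finally have "card ?E = 2 ^ (4 * t - 1)" .
  moreover have "\<zero>\<^bsub>?R\<^esub> \<in> ?E"
    by (simp add: lipschitz_ring_simps)
  ultimately show ?thesis
    by (simp add: nonzero_zero_divisors_lipschitz_power_of_2[OF t] card_Diff_singleton)
qed

section \<open>Pairwise annihilating multiples\<close>

text \<open>For a divisor \<open>m\<close> of \<open>n\<close>, this is the ideal generated by \<open>m\<close>.\<close>

definition lipschitz_multiples :: "nat \<Rightarrow> nat \<Rightarrow> (int \<times> int \<times> int \<times> int) set" where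
  "lipschitz_multiples m n =
    {(a, b, c, d) \<in> carrier (lipschitz_ring n). int m dvd a \<and> int m dvd b \<and> int m dvd c \<and> int m dvd d}"

lemma lipschitz_multiples_mult_eq_zero:
  assumes n: "n \<ge> 2" "n dvd m\<^sup>2" and xy: "x \<in> lipschitz_multiples m n" "y \<in> lipschitz_multiples m n"
  shows "x \<otimes>\<^bsub>lipschitz_ring n\<^esub> y = \<zero>\<^bsub>lipschitz_ring n\<^esub>"
proof -
  obtain a b c d where x: "x = (a, b, c, d)" by (cases x)
  obtain a' b' c' d' where y: "y = (a', b', c', d')" by (cases y)
  have "int n dvd int m * int m"
    using n(2) by (metis int_dvd_int_iff of_nat_mult power2_eq_square)
  then have "int n dvd u * v" if "int m dvd u" "int m dvd v" for u v
    using dvd_trans[OF _ mult_dvd_mono[OF that]] by blast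
  then show ?thesis
    using xy unfolding x y lipschitz_mult_eq_zero_iff[OF n(1)] lipschitz_multiples_def
    by (auto intro!: dvd_add[of "int n"] dvd_diff[of "int n"])
qed

lemma card_lipschitz_multiples:
  assumes "m > 0"
  shows "card (lipschitz_multiples m (m * k)) = k ^ 4"
proof -
  let ?S = "{x \<in> {0..int (m * k) - 1}. int m dvd x}"
  have "bij_betw (\<lambda>i. int m * i) {0..int k - 1} ?S"
  proof (rule bij_betw_byWitness[where f' = "\<lambda>x. x div int m"])
    have "int m * i \<le> int m * int k - 1" if "i \<le> int k - 1" for i
      using mult_left_mono[OF that, of "int m"] assms by (simp add: algebra_simps)
    then show "(*) (int m) ` {0..int k - 1} \<subseteq> ?S"
      by auto
    have "x div int m \<le> int k - 1" if "x \<le> int m * int k - 1" for x :: int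
    proof -
      have "int m * (x div int m) < int m * int k"
        using that assms pos_mod_sign[of "int m" x] unfolding minus_mod_eq_mult_div[symmetric] by linarith
      then show ?thesis
        by (simp add: mult_less_cancel_left)
    qed
    then show "(\<lambda>x. x div int m) ` ?S \<subseteq> {0..int k - 1}"
      using assms by (auto simp: pos_imp_zdiv_nonneg_iff)
  qed (use assms in auto)
  then have "card ?S = k"
    using bij_betw_same_card by fastforce
  moreover have "lipschitz_multiples m (m * k) = ?S \<times> ?S \<times> ?S \<times> ?S"
    by (auto simp: lipschitz_multiples_def lipschitz_ring_simps)
  ultimately show ?thesis
    by (simp add: card_cartesian_product power4_eq_xxxx)
qed

section \<open>Inertia of the zero-divisor graph\<close>

theorem theorem5p7:
  fixes t :: nat and vs :: "(int \<times> int \<times> int \<times> int) list"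
  assumes "t \<ge> 2"
    and "distinct vs" and "set vs = pverts (lipschitz_graph (2 ^ t))"
  shows "let A = adjacency_matrix (lipschitz_graph (2 ^ t)) vs;
             N = int (card (pverts (lipschitz_graph (2 ^ t))));
             c = (2 ^ (4 * (t div 2)) - 1 :: int)
         in N = 2 ^ (4 * t - 1) - 1 \<and>
            int (positive_inertia A) \<ge> 1 \<and>
            int (negative_inertia A) \<ge> c - 1 \<and>
            int (mat_rank A) \<ge> c \<and>
            int (zero_inertia A) \<le> N - c"
proof -
  let ?R = "lipschitz_ring (2 ^ t)"
  let ?G = "lipschitz_graph (2 ^ t)"
  let ?A = "adjacency_matrix ?G vs"
  define h where "h = t div 2"
  define m :: nat where "m = 2 ^ (t - h)"
  define K where "K = lipschitz_multiples m (2 ^ t) - {\<zero>\<^bsub>?R\<^esub>}"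
  have n: "(2 :: nat) ^ t \<ge> 2"
    using assms(1) self_le_power[of 2 t] by simp
  have n_eq: "2 ^ t = m * 2 ^ h"
    by (simp add: m_def h_def power_add[symmetric])
  have "2 ^ t dvd m\<^sup>2"
    unfolding m_def power_mult[symmetric] h_def by (rule le_imp_power_dvd) simp
  then have mult0: "x \<otimes>\<^bsub>?R\<^esub> y = \<zero>\<^bsub>?R\<^esub>" if "x \<in> K" "y \<in> K" for x y
    using that lipschitz_multiples_mult_eq_zero[OF n] by (simp add: K_def)
  have K_carrier: "K \<subseteq> carrier ?R - {\<zero>\<^bsub>?R\<^esub>}"
    by (auto simp: K_def lipschitz_multiples_def)
  have K_zero_divisors: "x \<in> nonzero_zero_divisors ?R" if "x \<in> K" for x
    using that K_carrier mult0[OF that that] unfolding nonzero_zero_divisors_def by blast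
  then have K_verts: "K \<subseteq> pverts ?G"
    by (simp add: zero_divisor_graph_def subsetI)
  have K_arcs: "(x, y) \<in> parcs ?G" if "x \<in> K" "y \<in> K" "x \<noteq> y" for x y
    using that K_zero_divisors mult0 by (simp add: zero_divisor_graph_def)
  have zero: "\<zero>\<^bsub>?R\<^esub> \<in> lipschitz_multiples m (2 ^ t)"
    by (simp add: lipschitz_multiples_def lipschitz_ring_simps)
  have "card (lipschitz_multiples m (2 ^ t)) = 2 ^ (4 * h)"
    unfolding n_eq by (subst card_lipschitz_multiples) (simp_all add: m_def power_mult[symmetric] mult.commute)
  then have card_K: "card K = 2 ^ (4 * h) - 1"
    using zero by (simp add: K_def card_Diff_singleton)
  have "(2 :: nat) ^ 4 \<le> 2 ^ (4 * h)"
    using assms(1) by (intro power_increasing) (auto simp: h_def)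
  then have card_K_ge: "card K \<ge> 2" and card_K_int: "int (card K) = 2 ^ (4 * h) - 1"
    by (simp_all add: card_K of_nat_diff)

  let ?I = "{i. i < length vs \<and> vs ! i \<in> K}"
  have card_I: "card ?I = card K"
    and "matrix_with_clique (length vs) ?A ?I"
    using adjacency_matrix_clique[OF pair_graph_lipschitz_graph assms(2), of K] K_verts K_arcs assms(3)
    by auto
  then interpret matrix_with_clique "length vs" ?A ?I by simp
  have len: "length vs = card (pverts ?G)"
    using distinct_card[OF assms(2)] assms(3) by simp
  have N: "int (card (pverts ?G)) = 2 ^ (4 * t - 1) - 1"
    using card_nonzero_zero_divisors_lipschitz_power_of_2[of t] assms(1)
    by (simp add: zero_divisor_graph_def of_nat_diff)
  have pos: "1 \<le> positive_inertia ?A"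
    using one_le_positive_inertia card_I card_K_ge by simp
  have neg: "card K - 1 \<le> negative_inertia ?A"
    using card_clique_minus_1_le_negative_inertia card_I by simp
  have rank: "card K \<le> mat_rank ?A"
    using card_clique_le_rank card_I card_K_ge by simp
  have "positive_inertia ?A + negative_inertia ?A + zero_inertia ?A = card (pverts ?G)"
    using inertia_sum[OF A sym] len by simp
  then have "int (zero_inertia ?A) \<le> int (card (pverts ?G)) - int (card K)"
    using pos neg card_K_ge by linarith
  moreover have "int (card K) - 1 \<le> int (negative_inertia ?A)" "int (card K) \<le> int (mat_rank ?A)"
    using neg rank by linarith+
  ultimately show ?thesis
    using N pos unfolding Let_def card_K_int h_def by simp
qed

end
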